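(* Let $(X,G)$ be a topological dynamical system and let $m\in\mathbb{N}$. (i) If $(X,G)$ is transitive, then it is either almost frequently $m$-stable or strongly $m$-spreading. (ii) If $(X,G)$ is minimal, then it is either frequently $m$-stable or strongly $m$-spreading.
   Context: A topological dynamical system (tds) $(X,G)$ consists of a compact metric space $X$ with metric $d$ and a countably infinite discrete amenable group $G$ acting on $X$ by homeomorphisms; the action is written $x\mapsto gx$, and $gU=\{gx : x\in U\}$. The tds is transitive if some point has a dense orbit, and minimal if all orbits are dense. $\mathbb{N}=\{1,2,\dots\}$. A Følner sequence is a sequence $\mathcal{F}=(\mathcal{F}_n)_{n\in\mathbb{N}}$ of nonempty finite subsets of $G$ with $\lim_{n\to\infty}|\mathcal{F}_n\triangle K\mathcal{F}_n|/|\mathcal{F}_n|=0$ for every nonempty finite $K\subseteq G$. For $S\subseteq G$ the upper Banach density is $\overline{\mathrm{BD}}(S)=\sup_{\mathcal{F}}\limsup_{n\to\infty}|S\cap\mathcal{F}_n|/|\mathcal{F}_n|$, the supremum being over all Følner sequences of $G$. For $x_1,\dots,x_m\in X$ let $D_m(x_1,\dots,x_m)=\min_{1\le i<j\le m}d(x_i,x_j)$, and for $A\subseteq X$ let $\mathrm{Diam}_m(A)=\sup\{D_m(x_1,\dots,x_m) : (x_1,\dots,x_m)\in A^m\}$. Conventions: $\min\emptyset=+\infty$ (relevant only for $m=1$), $\mathrm{Diam}_m(\emptyset)=0$. $\mathrm{Diam}(A)$ denotes the usual diameter. $(X,G)$ is frequently $m$-stable if for all $\varepsilon>0$ there is $\delta>0$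 such that $\overline{\mathrm{BD}}(\{g\in G : \mathrm{Diam}_m(gA)<\varepsilon\})>0$ for all nonempty $A\subseteq X$ with $\mathrm{Diam}(A)<\delta$. A point $x\in X$ is a frequent $m$-stability point if for all $\varepsilon>0$ there is $\delta>0$ such that $\overline{\mathrm{BD}}(\{g\in G : \mathrm{Diam}_m(gA)<\varepsilon\})>0$ for all $A\subseteq X$ with $x\in A$ and $\mathrm{Diam}(A)<\delta$. $(X,G)$ is almost frequently $m$-stable if the set of frequent $m$-stability points is residual in $X$. $(X,G)$ is strongly $m$-spreading if there is $\varepsilon>0$ such that $\overline{\mathrm{BD}}(\{g\in G : \mathrm{Diam}_m(gU)<\varepsilon\})=0$ for all nonempty open $U\subseteq X$. "Either ... or" means that exactly one of the two alternatives holds. *)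

theory Defs
  imports "HOL-Analysis.Analysis" "HOL-Algebra.Group_Action"
begin

definition folner_seq :: "('g, 'b) monoid_scheme \<Rightarrow> (nat \<Rightarrow> 'g set) \<Rightarrow> bool" where
  "folner_seq G F \<longleftrightarrow>
     (\<forall>n. F n \<subseteq> carrier G \<and> finite (F n) \<and> F n \<noteq> {}) \<and>
     (\<forall>K. K \<subseteq> carrier G \<and> finite K \<and> K \<noteq> {} \<longrightarrow>
        (\<lambda>n. real (card (sym_diff (F n) (K <#>\<^bsub>G\<^esub> F n))) / real (card (F n))) \<longlonglongrightarrow> 0)"

text \<open>For a countable discrete group this is equivalent to the existence of an invariant mean.\<close>

definition amenable :: "('g, 'b) monoid_scheme \<Rightarrow> bool" where
  "amenable G \<longleftrightarrow> (\<exists>F. folner_seq G F)"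

definition upper_BD :: "('g, 'b) monoid_scheme \<Rightarrow> 'g set \<Rightarrow> ereal" where
  "upper_BD G S =
     (SUP F \<in> {F. folner_seq G F}.
        limsup (\<lambda>n. ereal (real (card (S \<inter> F n)) / real (card (F n)))))"

text \<open>The phase space is the whole (hence nonempty) type \<open>'x\<close>.\<close>

locale tds = group_action G "UNIV :: 'x set" \<phi>
  for G :: "('g, 'b) monoid_scheme" (structure) and \<phi> :: "'g \<Rightarrow> 'x::metric_space \<Rightarrow> 'x" +
  assumes compact_space: "compact (UNIV :: 'x set)"
    and countable_group: "countable (carrier G)"
    and infinite_group: "infinite (carrier G)"
    and amenable_group: "amenable G"
    and homeo: "\<And>g. g \<in> carrier G \<Longrightarrow> homeomorphism UNIV UNIV (\<phi> g) (\<phi> (inv g))"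

definition tds_transitive ::
    "('g, 'b) monoid_scheme \<Rightarrow> ('g \<Rightarrow> 'x::metric_space \<Rightarrow> 'x) \<Rightarrow> bool" where
  "tds_transitive G \<phi> \<longleftrightarrow> (\<exists>x. closure (orbit G \<phi> x) = UNIV)"

definition tds_minimal ::
    "('g, 'b) monoid_scheme \<Rightarrow> ('g \<Rightarrow> 'x::metric_space \<Rightarrow> 'x) \<Rightarrow> bool" where
  "tds_minimal G \<phi> \<longleftrightarrow> (\<forall>x. closure (orbit G \<phi> x) = UNIV)"

definition residual_set :: "'x::topological_space set \<Rightarrow> bool" where
  "residual_set R \<longleftrightarrow>
     (\<exists>\<U>. countable \<U> \<and> (\<forall>U\<in>\<U>. open U \<and> closure U = UNIV) \<and> \<Inter>\<U> \<subseteq> R)"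

text \<open>An \<open>m\<close>-tuple is a function on \<open>nat\<close> of which only the values at \<open>1, \<dots>, m\<close>
  are used. The infimum ranges over a finite set, so it is a minimum, except that it is
  \<open>\<infinity>\<close> when there are no pairs.\<close>

definition D_m :: "nat \<Rightarrow> (nat \<Rightarrow> 'x::metric_space) \<Rightarrow> ereal" where
  "D_m m x = (INF (i, j) \<in> {(i, j). 1 \<le> i \<and> i < j \<and> j \<le> m}. ereal (dist (x i) (x j)))"

definition Diam_m :: "nat \<Rightarrow> 'x::metric_space set \<Rightarrow> ereal" where
  "Diam_m m A = (if A = {} then 0 else (SUP x \<in> {1..m} \<rightarrow> A. D_m m x))"

text \<open>The library's \<^const>\<open>diameter\<close> is real-valued and is the usual diameter on bounded sets;
  in a compact space all sets are bounded.\<close>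

definition frequently_stable ::
    "('g, 'b) monoid_scheme \<Rightarrow> ('g \<Rightarrow> 'x::metric_space \<Rightarrow> 'x) \<Rightarrow> nat \<Rightarrow> bool" where
  "frequently_stable G \<phi> m \<longleftrightarrow>
     (\<forall>\<epsilon>::real. \<epsilon> > 0 \<longrightarrow> (\<exists>\<delta>::real. \<delta> > 0 \<and>
        (\<forall>A. A \<noteq> {} \<and> diameter A < \<delta> \<longrightarrow>
           upper_BD G {g \<in> carrier G. Diam_m m (\<phi> g ` A) < ereal \<epsilon>} > 0)))"

definition frequent_stability_point ::
    "('g, 'b) monoid_scheme \<Rightarrow> ('g \<Rightarrow> 'x::metric_space \<Rightarrow> 'x) \<Rightarrow> nat \<Rightarrow> 'x \<Rightarrow> bool" where
  "frequent_stability_point G \<phi> m x \<longleftrightarrow>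
     (\<forall>\<epsilon>::real. \<epsilon> > 0 \<longrightarrow> (\<exists>\<delta>::real. \<delta> > 0 \<and>
        (\<forall>A. x \<in> A \<and> diameter A < \<delta> \<longrightarrow>
           upper_BD G {g \<in> carrier G. Diam_m m (\<phi> g ` A) < ereal \<epsilon>} > 0)))"

definition almost_frequently_stable ::
    "('g, 'b) monoid_scheme \<Rightarrow> ('g \<Rightarrow> 'x::metric_space \<Rightarrow> 'x) \<Rightarrow> nat \<Rightarrow> bool" where
  "almost_frequently_stable G \<phi> m \<longleftrightarrow>
     residual_set {x. frequent_stability_point G \<phi> m x}"

definition strongly_spreading ::
    "('g, 'b) monoid_scheme \<Rightarrow> ('g \<Rightarrow> 'x::metric_space \<Rightarrow> 'x) \<Rightarrow> nat \<Rightarrow> bool" where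
  "strongly_spreading G \<phi> m \<longleftrightarrow>
     (\<exists>\<epsilon>::real. \<epsilon> > 0 \<and>
        (\<forall>U. open U \<and> U \<noteq> {} \<longrightarrow>
           upper_BD G {g \<in> carrier G. Diam_m m (\<phi> g ` U) < ereal \<epsilon>} = 0))"

end

theory Submission
  imports Defs
begin

text \<open>
  For a scale \<open>\<epsilon>\<close> let the stable region \<open>W \<epsilon>\<close> be the union of all open sets \<open>U\<close> for which
  \<open>{g. Diam_m (g U) < \<epsilon>}\<close> has positive upper Banach density. The system fails to be strongly
  \<open>m\<close>-spreading exactly when \<open>W \<epsilon>\<close> is nonempty for every \<open>\<epsilon> > 0\<close>
  (\<open>not_strongly_spreading_iff\<close>), whereas stability says that these regions are large. What
  drives the dichotomy is that \<open>W \<epsilon>\<close> is invariant under the action (\<open>stable_region_invariant\<close>):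
  the times \<open>g\<close> at which \<open>h U\<close> is contracted are the right translates by \<open>inv h\<close> of the
  times at which \<open>U\<close> is contracted. Although Folner sequences here are asymptotically invariant
  on the left, their right translates are again Folner sequences, since left and right translations
  commute and right translation preserves cardinalities. So the upper Banach density is invariant
  under right translation (\<open>upper_BD_le_right_translate\<close>).

  A nonempty open invariant set is dense in a transitive system and is the whole space in a minimal
  one. In the transitive case the intersection of the dense open sets \<open>W (1/n)\<close> is therefore
  residual, and it consists of frequent \<open>m\<close>-stability points. In the minimal case the open sets
  that make up \<open>W \<epsilon>\<close> cover the compact space, and a Lebesgue number of this cover is the
  \<open>\<delta>\<close> required by frequent \<open>m\<close>-stability.

  Conversely, a single frequent \<open>m\<close>-stability point excludes strong \<open>m\<close>-spreading, because
  small balls around it are nonempty open sets. Such a point exists in the almost frequently stable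
  case by the Baire category theorem.
\<close>

section \<open>Translation invariance of the upper Banach density\<close>

lemma upper_BD_mono:
  assumes "S \<subseteq> T"
  shows "upper_BD G S \<le> upper_BD G T"
  unfolding upper_BD_def
proof (rule SUP_subset_mono)
  fix F assume "F \<in> {F. folner_seq G F}"
  then have fin: "finite (F n)" for n
    by (simp add: folner_seq_def)
  have "card (S \<inter> F n) \<le> card (T \<inter> F n)" for n
    using fin assms by (intro card_mono) auto
  then show "limsup (\<lambda>n. ereal (real (card (S \<inter> F n)) / real (card (F n))))
      \<le> limsup (\<lambda>n. ereal (real (card (T \<inter> F n)) / real (card (F n))))"
    by (intro Limsup_mono always_eventually allI) (simp add: divide_right_mono)
qed simp

lemma upper_BD_nonneg:
  assumes "amenable G"
  shows "0 \<le> upper_BD G S"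
proof -
  obtain F where "folner_seq G F"
    using assms by (auto simp: amenable_def)
  moreover have "0 \<le> limsup (\<lambda>n. ereal (real (card (S \<inter> F n)) / real (card (F n))))"
    by (rule le_Limsup) auto
  ultimately show ?thesis
    unfolding upper_BD_def by (auto intro: SUP_upper2)
qed

lemma (in group) card_r_coset:
  assumes "A \<subseteq> carrier G" "h \<in> carrier G"
  shows "card (A #> h) = card A"
proof -
  have "A #> h = (\<lambda>a. a \<otimes> h) ` A"
    by (auto simp: r_coset_def)
  moreover have "inj_on (\<lambda>a. a \<otimes> h) A"
    using assms by (auto intro!: inj_onI simp: subset_iff)
  ultimately show ?thesis
    by (simp add: card_image)
qed

lemma (in group) sym_diff_r_coset:
  assumes "A \<subseteq> carrier G" "B \<subseteq> carrier G" "h \<in> carrier G"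
  shows "sym_diff (A #> h) (B #> h) = sym_diff A B #> h"
  using assms by (auto simp: r_coset_def subset_iff)

text \<open>Left and right translations commute, so right translation by \<open>h\<close> carries the sets
  that measure the left invariance of \<open>F n\<close> to those that measure it for \<open>F n #> h\<close>.\<close>

lemma (in group) folner_seq_r_coset:
  assumes F: "folner_seq G F" and h: "h \<in> carrier G"
  shows "folner_seq G (\<lambda>n. F n #> h)"
proof -
  have sub: "F n \<subseteq> carrier G" and fin: "finite (F n)" and ne: "F n \<noteq> {}" for n
    using F by (auto simp: folner_seq_def)
  have "sym_diff (F n #> h) (K <#> (F n #> h)) = sym_diff (F n) (K <#> F n) #> h"
    if "K \<subseteq> carrier G" for K n
    using sub that h by (simp add: setmult_rcos_assoc sym_diff_r_coset setmult_subset_G)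
  moreover have "sym_diff (F n) (K <#> F n) \<subseteq> carrier G" if "K \<subseteq> carrier G" for K n
    using sub[of n] setmult_subset_G[OF that sub] by blast
  ultimately have
    "real (card (sym_diff (F n #> h) (K <#> (F n #> h)))) / real (card (F n #> h))
      = real (card (sym_diff (F n) (K <#> F n))) / real (card (F n))"
    if "K \<subseteq> carrier G" for K n
    using sub that h by (simp add: card_r_coset)
  moreover have "F n #> h \<subseteq> carrier G" "finite (F n #> h)" "F n #> h \<noteq> {}" for n
    using sub[of n] fin[of n] ne[of n] h by (auto simp: r_coset_def)
  ultimately show ?thesis
    using F by (simp add: folner_seq_def)
qed

lemma (in group) upper_BD_le_right_translate:
  assumes h: "h \<in> carrier G"
  shows "upper_BD G S \<le> upper_BD G {g \<in> carrier G. g \<otimes> h \<in> S}" (is "_ \<le> upper_BD G ?T")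
  unfolding upper_BD_def
proof (rule SUP_mono)
  fix F assume "F \<in> {F. folner_seq G F}"
  then have F: "folner_seq G F"
    by simp
  then have sub: "F n \<subseteq> carrier G" for n
    by (auto simp: folner_seq_def)
  let ?F = "\<lambda>n. F n #> inv h"
  have F': "folner_seq G ?F"
    using F h by (simp add: folner_seq_r_coset)
  have "?T \<inter> ?F n = (S \<inter> F n) #> inv h" for n
    using sub[of n] h by (auto simp: r_coset_def m_assoc subset_iff)
  moreover have "S \<inter> F n \<subseteq> carrier G" for n
    using sub[of n] by blast
  ultimately have "card (?T \<inter> ?F n) = card (S \<inter> F n)" "card (?F n) = card (F n)" for n
    using sub h by (simp_all add: card_r_coset)
  then show "\<exists>F' \<in> {F. folner_seq G F}.
      limsup (\<lambda>n. ereal (real (card (S \<inter> F n)) / real (card (F n))))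
      \<le> limsup (\<lambda>n. ereal (real (card (?T \<inter> F' n)) / real (card (F' n))))"
    using F' by (intro bexI[of _ ?F]) simp_all
qed

section \<open>The stable region\<close>

lemma Diam_m_mono:
  assumes "A \<subseteq> B"
  shows "Diam_m m A \<le> Diam_m m B"
proof (cases "A = {}")
  case True
  \<comment> \<open>The convention \<open>Diam_m m {} = 0\<close> is consistent with monotonicity, since constant
    tuples show that nonempty sets have nonnegative \<open>m\<close>-diameter.\<close>
  have "0 \<le> Diam_m m B" if "b \<in> B" for b
  proof -
    have "0 \<le> D_m m (\<lambda>_. b)"
      by (auto simp: D_m_def intro!: INF_greatest)
    also have "\<dots> \<le> (SUP x \<in> {1..m} \<rightarrow> B. D_m m x)"
      using that by (intro SUP_upper) auto
    finally show ?thesis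
      using that unfolding Diam_m_def by (metis empty_iff)
  qed
  moreover have "Diam_m m A = 0"
    using True by (simp add: Diam_m_def)
  moreover have "Diam_m m B = 0" if "B = {}"
    using that by (simp add: Diam_m_def)
  ultimately show ?thesis
    by fastforce
next
  case False
  then have "B \<noteq> {}"
    using assms by blast
  moreover have "(SUP x \<in> {1..m} \<rightarrow> A. D_m m x) \<le> (SUP x \<in> {1..m} \<rightarrow> B. D_m m x)"
    using assms by (intro SUP_subset_mono Pi_mono) auto
  ultimately show ?thesis
    using False by (simp add: Diam_m_def)
qed

context tds
begin

abbreviation contraction_times :: "nat \<Rightarrow> real \<Rightarrow> 'x set \<Rightarrow> 'g set" where
  "contraction_times m \<epsilon> A \<equiv> {g \<in> carrier G. Diam_m m (\<phi> g ` A) < ereal \<epsilon>}"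

definition stable_open_sets :: "nat \<Rightarrow> real \<Rightarrow> 'x set set" where
  "stable_open_sets m \<epsilon> = {U. open U \<and> upper_BD G (contraction_times m \<epsilon> U) > 0}"

abbreviation stable_region :: "nat \<Rightarrow> real \<Rightarrow> 'x set" where
  "stable_region m \<epsilon> \<equiv> \<Union> (stable_open_sets m \<epsilon>)"

lemma group_G: "group G"
  using group_hom by (simp add: group_hom_def)

lemma upper_BD_contraction_times_mono:
  assumes "A \<subseteq> B" "\<epsilon> \<le> \<epsilon>'"
  shows "upper_BD G (contraction_times m \<epsilon> B) \<le> upper_BD G (contraction_times m \<epsilon>' A)"
proof (rule upper_BD_mono, safe)
  fix g assume "Diam_m m (\<phi> g ` B) < ereal \<epsilon>"
  moreover have "Diam_m m (\<phi> g ` A) \<le> Diam_m m (\<phi> g ` B)"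
    using assms(1) by (intro Diam_m_mono image_mono)
  ultimately show "Diam_m m (\<phi> g ` A) < ereal \<epsilon>'"
    using assms(2) by (metis ereal_less_eq(3) le_less_trans less_le_trans)
qed

lemma open_stable_region: "open (stable_region m \<epsilon>)"
  by (auto simp: stable_open_sets_def)

lemma open_action_image:
  assumes "g \<in> carrier G" "open U"
  shows "open (\<phi> g ` U)"
  using homeomorphism_imp_open_map[OF homeo[OF assms(1)]] assms(2) by simp

text \<open>The set \<open>h U\<close> is contracted at time \<open>g\<close> if and only if \<open>U\<close> is contracted at time
  \<open>g h\<close>, so the density does not change from \<open>U\<close> to \<open>h U\<close>.\<close>

lemma stable_open_sets_image:
  assumes U: "U \<in> stable_open_sets m \<epsilon>" and h: "h \<in> carrier G"
  shows "\<phi> h ` U \<in> stable_open_sets m \<epsilon>"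
proof -
  interpret group G by (rule group_G)
  have "{g \<in> carrier G. g \<otimes> h \<in> contraction_times m \<epsilon> U} = contraction_times m \<epsilon> (\<phi> h ` U)"
    using h by (auto simp: composition_rule image_image)
  then have "upper_BD G (contraction_times m \<epsilon> U) \<le> upper_BD G (contraction_times m \<epsilon> (\<phi> h ` U))"
    using upper_BD_le_right_translate[OF h, of "contraction_times m \<epsilon> U"] by simp
  then show ?thesis
    using U h open_action_image by (auto simp: stable_open_sets_def)
qed

lemma stable_region_invariant:
  assumes "x \<in> stable_region m \<epsilon>" "h \<in> carrier G"
  shows "\<phi> h x \<in> stable_region m \<epsilon>"
  using assms stable_open_sets_image by blast

lemma not_strongly_spreading_iff:
  "\<not> strongly_spreading G \<phi> m \<longleftrightarrow> (\<forall>\<epsilon>>0. stable_region m \<epsilon> \<noteq> {})"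
proof -
  have "upper_BD G S \<noteq> 0 \<longleftrightarrow> upper_BD G S > 0" for S
    using upper_BD_nonneg[OF amenable_group, of S] by (simp add: order_less_le)
  then show ?thesis
    by (fastforce simp: strongly_spreading_def stable_open_sets_def)
qed

section \<open>Invariant open sets\<close>

text \<open>If the orbit closure of \<open>x\<close> is the whole space, then some orbit point lies
  in \<open>W\<close>. All other orbit points are images of this one, so invariance puts them in \<open>W\<close>.\<close>

lemma dense_orbit_subset_invariant_open:
  assumes "closure (orbit G \<phi> x) = UNIV" "open W" "W \<noteq> {}"
    and inv: "\<And>h y. h \<in> carrier G \<Longrightarrow> y \<in> W \<Longrightarrow> \<phi> h y \<in> W"
  shows "orbit G \<phi> x \<subseteq> W"
proof
  fix y assume y: "y \<in> orbit G \<phi> x"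
  have "W \<inter> orbit G \<phi> x \<noteq> {}"
    using assms(1-3) open_Int_closure_eq_empty[of W "orbit G \<phi> x"] by auto
  then obtain z where z: "z \<in> W" "z \<in> orbit G \<phi> x"
    by blast
  then have "x \<in> orbit G \<phi> z"
    using orbit_sym[OF UNIV_I UNIV_I] by simp
  then have "y \<in> orbit G \<phi> z"
    using orbit_trans[OF UNIV_I UNIV_I UNIV_I] y by simp
  then show "y \<in> W"
    using z inv by (auto simp: orbit_def)
qed

lemma closure_stable_region_if_transitive:
  assumes "tds_transitive G \<phi>" "stable_region m \<epsilon> \<noteq> {}"
  shows "closure (stable_region m \<epsilon>) = UNIV"
proof -
  obtain x where x: "closure (orbit G \<phi> x) = UNIV"
    using assms(1) by (auto simp: tds_transitive_def)
  have "orbit G \<phi> x \<subseteq> stable_region m \<epsilon>"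
    using x open_stable_region assms(2) stable_region_invariant
    by (rule dense_orbit_subset_invariant_open)
  then show ?thesis
    using x closure_mono[of "orbit G \<phi> x" "stable_region m \<epsilon>"] by (simp add: top.extremum_unique)
qed

lemma stable_region_if_minimal:
  assumes "tds_minimal G \<phi>" "stable_region m \<epsilon> \<noteq> {}"
  shows "stable_region m \<epsilon> = UNIV"
proof -
  have "x \<in> stable_region m \<epsilon>" for x
  proof -
    have "closure (orbit G \<phi> x) = UNIV"
      using assms(1) by (auto simp: tds_minimal_def)
    then have "orbit G \<phi> x \<subseteq> stable_region m \<epsilon>"
      using open_stable_region assms(2) stable_region_invariant
      by (rule dense_orbit_subset_invariant_open)
    then show ?thesis
      using orbit_refl[of x] by (simp add: subset_iff)
  qed
  then show ?thesis
    by blast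
qed

section \<open>From stable regions to stability\<close>

lemma frequent_stability_pointI:
  assumes "\<And>n. x \<in> stable_region m (1 / real (Suc n))"
  shows "frequent_stability_point G \<phi> m x"
  unfolding frequent_stability_point_def
proof (intro allI impI)
  fix \<epsilon> :: real assume "\<epsilon> > 0"
  then obtain n where n: "1 / real (Suc n) < \<epsilon>"
    by (rule nat_approx_posE)
  obtain U where U: "open U" "x \<in> U"
    "upper_BD G (contraction_times m (1 / real (Suc n)) U) > 0"
    using assms[of n] by (auto simp: stable_open_sets_def)
  obtain \<delta> where \<delta>: "\<delta> > 0" "ball x \<delta> \<subseteq> U"
    using U openE by blast
  have "upper_BD G (contraction_times m \<epsilon> A) > 0" if A: "x \<in> A" "diameter A < \<delta>" for A
  proof -
    have "bounded A"
      using compact_space bounded_subset compact_imp_bounded by blast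
    then have "dist x y < \<delta>" if "y \<in> A" for y
      using A that diameter_bounded_bound[of A x y] by simp
    then have "A \<subseteq> U"
      using \<delta>(2) by (auto simp: subset_iff)
    then show ?thesis
      using upper_BD_contraction_times_mono[of A U "1 / real (Suc n)" \<epsilon> m] n U(3) by simp
  qed
  then show "\<exists>\<delta>>0. \<forall>A. x \<in> A \<and> diameter A < \<delta> \<longrightarrow> upper_BD G (contraction_times m \<epsilon> A) > 0"
    using \<delta>(1) by blast
qed

lemma almost_frequently_stable_if_transitive:
  assumes "tds_transitive G \<phi>" "\<not> strongly_spreading G \<phi> m"
  shows "almost_frequently_stable G \<phi> m"
proof -
  let ?\<U> = "range (\<lambda>n. stable_region m (1 / real (Suc n)))"
  have "closure (stable_region m (1 / real (Suc n))) = UNIV" for n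
    using assms by (intro closure_stable_region_if_transitive) (auto simp: not_strongly_spreading_iff)
  then have "\<forall>U\<in>?\<U>. open U \<and> closure U = UNIV"
    using open_stable_region by blast
  moreover have "\<Inter>?\<U> \<subseteq> {x. frequent_stability_point G \<phi> m x}"
    by (auto intro!: frequent_stability_pointI)
  ultimately show ?thesis
    unfolding almost_frequently_stable_def residual_set_def
    by (intro exI[of _ ?\<U>]) auto
qed

lemma frequently_stable_if_minimal:
  assumes "tds_minimal G \<phi>" "\<not> strongly_spreading G \<phi> m"
  shows "frequently_stable G \<phi> m"
  unfolding frequently_stable_def
proof (intro allI impI)
  fix \<epsilon> :: real assume "\<epsilon> > 0"
  then have cover: "stable_region m \<epsilon> = UNIV"
    using assms by (intro stable_region_if_minimal) (auto simp: not_strongly_spreading_iff)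
  obtain \<delta> where \<delta>: "\<delta> > 0"
    "\<And>A. A \<subseteq> UNIV \<Longrightarrow> diameter A < \<delta> \<Longrightarrow> \<exists>U \<in> stable_open_sets m \<epsilon>. A \<subseteq> U"
  proof (rule Lebesgue_number_lemma[OF compact_space])
    show "stable_open_sets m \<epsilon> \<noteq> {}" "UNIV \<subseteq> stable_region m \<epsilon>"
      using cover by auto
    show "open U" if "U \<in> stable_open_sets m \<epsilon>" for U
      using that by (simp add: stable_open_sets_def)
  qed blast
  have "upper_BD G (contraction_times m \<epsilon> A) > 0" if "diameter A < \<delta>" for A
  proof -
    obtain U where "U \<in> stable_open_sets m \<epsilon>" "A \<subseteq> U"
      using \<delta>(2) \<open>diameter A < \<delta>\<close> by blast
    then show ?thesis
      using upper_BD_contraction_times_mono[of A U \<epsilon> \<epsilon> m] by (auto simp: stable_open_sets_def)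
  qed
  then show "\<exists>\<delta>>0. \<forall>A. A \<noteq> {} \<and> diameter A < \<delta> \<longrightarrow> upper_BD G (contraction_times m \<epsilon> A) > 0"
    using \<delta>(1) by blast
qed

section \<open>Stability excludes strong spreading\<close>

lemma not_strongly_spreading_if_frequent_stability_point:
  assumes "frequent_stability_point G \<phi> m x"
  shows "\<not> strongly_spreading G \<phi> m"
  unfolding not_strongly_spreading_iff
proof (intro allI impI)
  fix \<epsilon> :: real assume "\<epsilon> > 0"
  with assms have "\<exists>\<delta>>0. \<forall>A. x \<in> A \<and> diameter A < \<delta> \<longrightarrow> upper_BD G (contraction_times m \<epsilon> A) > 0"
    by (simp add: frequent_stability_point_def)
  then obtain \<delta> where \<delta>: "\<delta> > 0"
    "\<forall>A. x \<in> A \<and> diameter A < \<delta> \<longrightarrow> upper_BD G (contraction_times m \<epsilon> A) > 0"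
    by (elim exE conjE)

  \<comment> \<open>The radius is \<open>\<delta> / 3\<close> and not \<open>\<delta> / 2\<close> because the bound \<open>diameter A < \<delta>\<close>
    is strict.\<close>
  have "dist y z \<le> 2 * (\<delta> / 3)" if "y \<in> ball x (\<delta> / 3)" "z \<in> ball x (\<delta> / 3)" for y z
    using that dist_triangle3[of y z x] by simp
  then have "(SUP (y, z) \<in> ball x (\<delta> / 3) \<times> ball x (\<delta> / 3). dist y z) \<le> 2 * (\<delta> / 3)"
    using \<delta>(1) by (intro cSUP_least) (auto simp del: mem_ball)
  then have "diameter (ball x (\<delta> / 3)) \<le> 2 * (\<delta> / 3)"
    using \<delta>(1) by (simp add: diameter_def)
  then have "ball x (\<delta> / 3) \<in> stable_open_sets m \<epsilon>"
    using \<delta> by (simp add: stable_open_sets_def)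
  moreover have "x \<in> ball x (\<delta> / 3)"
    using \<delta>(1) by simp
  ultimately show "stable_region m \<epsilon> \<noteq> {}"
    by blast
qed

lemma frequent_stability_point_if_frequently_stable:
  assumes "frequently_stable G \<phi> m"
  shows "frequent_stability_point G \<phi> m x"
  unfolding frequent_stability_point_def
proof (intro allI impI)
  fix \<epsilon> :: real assume "\<epsilon> > 0"
  with assms have "\<exists>\<delta>>0. \<forall>A. A \<noteq> {} \<and> diameter A < \<delta> \<longrightarrow> upper_BD G (contraction_times m \<epsilon> A) > 0"
    by (simp add: frequently_stable_def)
  then obtain \<delta> where "\<delta> > 0"
    "\<forall>A. A \<noteq> {} \<and> diameter A < \<delta> \<longrightarrow> upper_BD G (contraction_times m \<epsilon> A) > 0"
    by (elim exE conjE)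
  then show "\<exists>\<delta>>0. \<forall>A. x \<in> A \<and> diameter A < \<delta> \<longrightarrow> upper_BD G (contraction_times m \<epsilon> A) > 0"
    by (intro exI[of _ \<delta>]) auto
qed

lemma residual_set_nonempty:
  assumes "residual_set (R :: 'x set)"
  shows "R \<noteq> {}"
proof -
  obtain \<U> :: "'x set set" where \<U>: "countable \<U>" "\<And>U. U \<in> \<U> \<Longrightarrow> open U \<and> closure U = UNIV"
    "\<Inter>\<U> \<subseteq> R"
    using assms by (auto simp: residual_set_def)
  have "compact_space (euclidean :: 'x topology)"
    using compact_space by (simp add: compact_space_def)
  then have "locally_compact_space (euclidean :: 'x topology)" "regular_space (euclidean :: 'x topology)"
    by (simp_all add: compact_imp_locally_compact_space compact_Hausdorff_imp_regular_space)
  then have "euclidean closure_of \<Inter>\<U> = topspace (euclidean :: 'x topology)"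
    using \<U>(1,2) by (intro Baire_category) auto
  then show ?thesis
    using \<U>(3) by auto
qed

end

theorem theorem1p2:
  fixes G :: "('g, 'b) monoid_scheme"
    and \<phi> :: "'g \<Rightarrow> 'x::metric_space \<Rightarrow> 'x"
    and m :: nat
  assumes "tds G \<phi>" and "m \<ge> 1"
  shows "(tds_transitive G \<phi> \<longrightarrow>
            (almost_frequently_stable G \<phi> m \<and> \<not> strongly_spreading G \<phi> m) \<or>
            (\<not> almost_frequently_stable G \<phi> m \<and> strongly_spreading G \<phi> m)) \<and>
         (tds_minimal G \<phi> \<longrightarrow>
            (frequently_stable G \<phi> m \<and> \<not> strongly_spreading G \<phi> m) \<or>
            (\<not> frequently_stable G \<phi> m \<and> strongly_spreading G \<phi> m))"
proof -
  interpret tds G \<phi> by fact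
  have "\<not> strongly_spreading G \<phi> m" if "almost_frequently_stable G \<phi> m"
    using that residual_set_nonempty not_strongly_spreading_if_frequent_stability_point
    unfolding almost_frequently_stable_def by blast
  moreover have "\<not> strongly_spreading G \<phi> m" if "frequently_stable G \<phi> m"
    using that frequent_stability_point_if_frequently_stable
      not_strongly_spreading_if_frequent_stability_point by blast
  ultimately show ?thesis
    using almost_frequently_stable_if_transitive frequently_stable_if_minimal by blast
qed

end
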